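(* Let $b,c$ be positive integers with $g=\gcd(b,c)>2$ and $\frac{b+c}{g}=2^{2l-1}$ for an integer $l\ge 2$. Let $M(a)=\begin{pmatrix} c-g+a & b\\ c & b-g+a\end{pmatrix}$. 1. If $g$ is even, let $a=0$ if $g/2\equiv 0$, $a=2$ if $g/2\equiv 2$, $a=4$ if $g/2\equiv 1 \pmod 3$. Then for all nonnegative $m,n$ with $2m+n=\frac{g(2^{2l-1}-1)+a}{3}$ there is a perfect coloring of $D(m,n)$ with quotient matrix $M(a)$. 2. If $g$ is odd, let $a=0$ if $(g-3)/2\equiv 0$, $a=2$ if $(g-3)/2\equiv 2$, $a=4$ if $(g-3)/2\equiv 1\pmod 3$. Then for all nonnegative $m,n$ with $2m+n=\frac{g(2^{2l-1}-1)+a}{3}$, and with $m=0$ in case $l\ne 3$, there is a perfect coloring of $D(m,n)$ with quotient matrix $M(a)$. 3. If $g$ is odd, let $a=3$ if $(g-3)/2\equiv 0$, $a=5$ if $(g-3)/2\equiv 2$, $a=7$ if $(g-3)/2\equiv 1\pmod 3$. Then for $m$ with $2m=\frac{g(2^{2l-1}-1)+a}{3}$ there is a perfect coloring of $D(m,0)$ with quotient matrix $M(a)$. 4. If $g$ is odd and $l=3$, with $a$ as in item 3, then for all nonnegative $m,n$ with $2m+n=\frac{g(2^{2l-1}-1)+a}{3}$ there is a perfect coloring of $D(m,n)$ with quotient matrix $M(a)$.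
   Context: The Shrikhande graph is the Cayley graph on $\mathbb{Z}_4^2$ with connection set $\{01,03,10,30,11,33\}$. For nonnegative integers $m,n$, $D(m,n)$ is the Cartesian product of $m$ copies of the Shrikhande graph and $n$ copies of $K_4$ (vertex set $(\mathbb{Z}_4^2)^m\times\mathbb{Z}_4^n$; adjacent iff differing in exactly one coordinate by an adjacency of that factor). A $2$-coloring (surjective map onto colors $\{1,2\}$) is perfect with quotient matrix $(s_{ij})$ if every vertex of color $i$ has exactly $s_{ij}$ neighbours of color $j$. *)

theory Defs
  imports "HOL-Analysis.Analysis"
begin

(* The numeral type 4 of HOL-Library.Numeral_Type carries arithmetic modulo 4, so it is the
   ring Z_4, and 4 \<times> 4 with componentwise addition is the group Z_4^2. *)

definition cayley_adj :: "'a::group_add set \<Rightarrow> 'a \<Rightarrow> 'a \<Rightarrow> bool" where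
  "cayley_adj S u v \<longleftrightarrow> v - u \<in> S"

definition shrikhande_adj :: "4 \<times> 4 \<Rightarrow> 4 \<times> 4 \<Rightarrow> bool" where
  "shrikhande_adj = cayley_adj {(0,1), (0,3), (1,0), (3,0), (1,1), (3,3)}"

definition K4_adj :: "4 \<Rightarrow> 4 \<Rightarrow> bool" where
  "K4_adj u v \<longleftrightarrow> u \<noteq> v"

(* A tuple with k entries is a function on nat that is extensional on {..<k}. *)

type_synonym doob_vertex = "(nat \<Rightarrow> 4 \<times> 4) \<times> (nat \<Rightarrow> 4)"

definition doob_vertices :: "nat \<Rightarrow> nat \<Rightarrow> doob_vertex set" where
  "doob_vertices m n = ({..<m} \<rightarrow>\<^sub>E UNIV) \<times> ({..<n} \<rightarrow>\<^sub>E UNIV)"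

definition doob_adj :: "nat \<Rightarrow> nat \<Rightarrow> doob_vertex \<Rightarrow> doob_vertex \<Rightarrow> bool" where
  "doob_adj m n = (\<lambda>(x, y) (x', y').
     (\<exists>i<m. shrikhande_adj (x i) (x' i) \<and> (\<forall>j<m. j \<noteq> i \<longrightarrow> x j = x' j) \<and> (\<forall>j<n. y j = y' j)) \<or>
     (\<exists>i<n. K4_adj (y i) (y' i) \<and> (\<forall>j<m. x j = x' j) \<and> (\<forall>j<n. j \<noteq> i \<longrightarrow> y j = y' j)))"

(* The colors are the elements of a finite type 'c. For two colors this is the type 2, whose
   elements are 1 and 2 (the latter being equal to 0 there). *)

definition perfect_coloring ::
    "'v set \<Rightarrow> ('v \<Rightarrow> 'v \<Rightarrow> bool) \<Rightarrow> ('v \<Rightarrow> 'c::finite) \<Rightarrow> int ^ 'c ^ 'c \<Rightarrow> bool" where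
  "perfect_coloring V adj f S \<longleftrightarrow>
     f ` V = UNIV \<and>
     (\<forall>v\<in>V. \<forall>j. int (card {w \<in> V. adj v w \<and> f w = j}) = S $ f v $ j)"

definition quotient_matrix :: "nat \<Rightarrow> nat \<Rightarrow> nat \<Rightarrow> int ^ 2 ^ 2" where
  "quotient_matrix b c a =
     (let g = int (gcd b c)
      in vector [vector [int c - g + int a, int b],
                 vector [int c, int b - g + int a]])"

end

theory Submission
  imports Defs "HOL-Library.Function_Algebras" "HOL-Library.Multiset" "HOL-Library.Z2"
begin

text \<open>
  Let \<open>A\<close> be an elementary abelian group of order \<open>2\<^sup>2\<^sup>l\<^sup>-\<^sup>1\<close>. If a map from \<open>D(m,n)\<close> to \<open>A\<close> is such that around
  every vertex the differences of values along the edges hit every nonzero element of \<open>A\<close> exactly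
  \<open>g\<close> times and \<open>0\<close> exactly \<open>a\<close> times, then the preimage of any subset of size \<open>c/g\<close> is a color class
  of a perfect coloring with matrix \<open>M(a)\<close>. Such a map is a sum of maps of the factors: \<open>K\<^sub>4\<close> contributes
  a (possibly degenerate) line \<open>p, q, p+q\<close>, and the Shrikhande graph has a map, not a homomorphism,
  contributing two lines \<open>x, y, x+y\<close> and \<open>x, w, x+w\<close> through a common point. So it
  suffices to cover \<open>A\<close> by pairs of lines with a common point, plus at most one further line; a pair can
  be used for one Shrikhande factor or for two factors \<open>K\<^sub>4\<close>, which gives all \<open>m\<close> and \<open>n\<close>.
  These coverings are written down in dimension 3 (the Fano plane) and extended by two dimensions
  at a time.
\<close>

section \<open>Groups of exponent two\<close>

class boolean_group = ab_group_add +
  assumes add_self [simp]: "x + x = 0"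

instance bit :: boolean_group
proof
  show "x + x = 0" for x :: bit by (cases x) simp_all
qed

instance "fun" :: (type, boolean_group) boolean_group
proof
  show "x + x = 0" for x :: "'a \<Rightarrow> 'b" by (rule ext) simp
qed

lemma add_left_self [simp]: "x + (x + y) = (y::'a::boolean_group)"
  by (simp add: add.assoc[symmetric])

lemma uminus_boolean [simp]: "- x = (x::'a::boolean_group)"
  using add_self[of x] by (simp add: minus_unique)

lemma diff_boolean [simp]: "x - y = x + (y::'a::boolean_group)"
  by (simp only: diff_conv_add_uminus uminus_boolean)

lemma add_eq_0_iff_boolean [simp]: "x + y = 0 \<longleftrightarrow> x = (y::'a::boolean_group)"
  by (metis add_left_self add.right_neutral)

section \<open>Lines, crosses and the colorings of the two factors\<close>

definition line_mset :: "'a::boolean_group \<times> 'a \<Rightarrow> 'a multiset" where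
  "line_mset = (\<lambda>(p, q). {#p, q, p + q#})"

definition cross_mset :: "'a::boolean_group \<times> 'a \<times> 'a \<Rightarrow> 'a multiset" where
  "cross_mset = (\<lambda>(x, y, w). line_mset (x, y) + line_mset (x, w))"

definition total_mset :: "('a::boolean_group \<times> 'a \<times> 'a) list \<Rightarrow> ('a \<times> 'a) list \<Rightarrow> 'a multiset" where
  "total_mset ts ls = (\<Sum>t\<leftarrow>ts. cross_mset t) + (\<Sum>l\<leftarrow>ls. line_mset l)"

definition line_coloring :: "'a::boolean_group \<times> 'a \<Rightarrow> 4 \<Rightarrow> 'a" where
  "line_coloring = (\<lambda>(p, q) k. if k = 1 then p else if k = 2 then q else if k = 3 then p + q else 0)"

text \<open>
  The second summand runs through \<open>0, y, y+w, w\<close> on the 4-cycle, so the two steps from any \<open>j\<close> change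
  it by \<open>y\<close> and \<open>w\<close> in some order.
\<close>

definition cross_coloring :: "'a::boolean_group \<times> 'a \<times> 'a \<Rightarrow> 4 \<times> 4 \<Rightarrow> 'a" where
  "cross_coloring = (\<lambda>(x, y, w) (i, j).
     (if i = 1 \<or> i = 3 then x else 0) +
     (if j = 1 then y else if j = 2 then y + w else if j = 3 then w else 0))"

lemma Z4_cases: "k = 0 \<or> k = 1 \<or> k = 2 \<or> k = (3::4)"
  using exhaust_4[of k] by auto

text \<open>The positions carry \<open>0, p, q, p + q\<close>; adding any one of these permutes the
  list, so the other three positions always differ from it by \<open>p\<close>, \<open>q\<close> and
  \<open>p + q\<close>. This also holds for degenerate lines.\<close>

lemma line_coloring_differences:
  "image_mset (\<lambda>s. line_coloring l s - line_coloring l k) (mset_set {s. K4_adj k s}) = line_mset l"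
proof -
  obtain p q where l: "l = (p, q)" by force
  have *: "{s. K4_adj k s} = {0,1,2,3} - {k}"
    using Z4_cases by (auto simp: K4_adj_def)
  show ?thesis
    using Z4_cases[of k] unfolding * l
    by (elim disjE) (simp_all add: line_coloring_def line_mset_def insert_Diff_if ac_simps add_mset_commute)
qed

text \<open>A step in \<open>i\<close> flips its parity and contributes \<open>x\<close>; the steps
  +1 and -1 in \<open>j\<close> contribute \<open>y\<close> and \<open>w\<close> in some order.
  Hence the steps in \<open>i\<close> alone give \<open>x\<close> twice, those in \<open>j\<close>
  alone give \<open>y, w\<close>, and the diagonal ones give \<open>x + y, x + w\<close>.\<close>

lemma cross_coloring_differences:
  "image_mset (\<lambda>s. cross_coloring t s - cross_coloring t u) (mset_set {s. shrikhande_adj u s}) = cross_mset t"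
proof -
  obtain x y w where t: "t = (x, y, w)" by (cases t)
  obtain i j where u: "u = (i, j)" by force
  let ?S = "{(0,1), (0,3), (1,0), (3,0), (1,1), (3,3)} :: (4 \<times> 4) set"
  have *: "{s. shrikhande_adj u s} = (+) u ` ?S"
    by (force simp: shrikhande_adj_def cayley_adj_def image_iff algebra_simps)
  have "mset_set {s. shrikhande_adj u s} = image_mset ((+) u) (mset_set ?S)"
    unfolding * by (rule image_mset_mset_set[symmetric]) simp
  moreover have "mset_set ?S = {#(0,1), (0,3), (1,0), (3,0), (1,1), (3,3)#}"
    by simp
  ultimately show ?thesis
    using Z4_cases[of i] Z4_cases[of j] unfolding t u
    by (elim disjE) (simp_all add: cross_coloring_def cross_mset_def line_mset_def ac_simps add_mset_commute)
qed

section \<open>Neighbour counts in the Doob graph\<close>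

text \<open>The neighbours of a vertex are split by the unique coordinate in which they differ from
  it.\<close>

lemma card_doob_neighbours:
  assumes "(x, y) \<in> doob_vertices m n"
  shows "card {w \<in> doob_vertices m n. doob_adj m n (x, y) w \<and> Q w} =
    (\<Sum>i<m. card {s. shrikhande_adj (x i) s \<and> Q (x(i := s), y)}) +
    (\<Sum>j<n. card {s. K4_adj (y j) s \<and> Q (x, y(j := s))})"
proof -
  define A where "A i = (\<lambda>s. (x(i := s), y)) ` {s. shrikhande_adj (x i) s \<and> Q (x(i := s), y)}" for i
  define B where "B j = (\<lambda>s. (x, y(j := s))) ` {s. K4_adj (y j) s \<and> Q (x, y(j := s))}" for j
  have x: "x \<in> {..<m} \<rightarrow>\<^sub>E UNIV" and y: "y \<in> {..<n} \<rightarrow>\<^sub>E UNIV"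
    using assms by (auto simp: doob_vertices_def)
  \<comment> \<open>Without loops, each neighbour really changes its coordinate, which makes the
    families \<open>A i\<close> and \<open>B j\<close> pairwise disjoint.\<close>
  have irrefl: "\<not> shrikhande_adj u u" "\<not> K4_adj k k" for u k
    by (auto simp: shrikhande_adj_def cayley_adj_def K4_adj_def zero_prod_def)
  have "{w \<in> doob_vertices m n. doob_adj m n (x, y) w \<and> Q w} = (\<Union>i<m. A i) \<union> (\<Union>j<n. B j)"
    (is "?N = ?U")
  proof (intro set_eqI iffI)
    fix w assume w: "w \<in> ?N"
    obtain x' y' where w_eq: "w = (x', y')" by force
    have x': "x' \<in> {..<m} \<rightarrow>\<^sub>E UNIV" and y': "y' \<in> {..<n} \<rightarrow>\<^sub>E UNIV"
      using w w_eq by (auto simp: doob_vertices_def)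
    from w w_eq consider
      i where "i < m" "shrikhande_adj (x i) (x' i)" "\<forall>j<m. j \<noteq> i \<longrightarrow> x j = x' j" "\<forall>j<n. y j = y' j"
    | i where "i < n" "K4_adj (y i) (y' i)" "\<forall>j<m. x j = x' j" "\<forall>j<n. j \<noteq> i \<longrightarrow> y j = y' j"
      by (auto simp: doob_adj_def)
    then show "w \<in> ?U"
    proof cases
      case 1
      have "x' = x(i := x' i)"
        by (rule PiE_ext[OF x']) (use 1 x in \<open>auto simp: PiE_iff extensional_def\<close>)
      moreover have "y' = y"
        by (rule PiE_ext[OF y' y]) (use 1 in auto)
      ultimately have "w = (x(i := x' i), y)" by (simp add: w_eq)
      then have "w \<in> A i"
        using w 1 unfolding A_def by (intro image_eqI[of _ _ "x' i"]) auto
      then show ?thesis using 1 by auto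
    next
      case 2
      have "y' = y(i := y' i)"
        by (rule PiE_ext[OF y']) (use 2 y in \<open>auto simp: PiE_iff extensional_def\<close>)
      moreover have "x' = x"
        by (rule PiE_ext[OF x' x]) (use 2 in auto)
      ultimately have "w = (x, y(i := y' i))" by (simp add: w_eq)
      then have "w \<in> B i"
        using w 2 unfolding B_def by (intro image_eqI[of _ _ "y' i"]) auto
      then show ?thesis using 2 by auto
    qed
  next
    fix w assume "w \<in> ?U"
    then consider
      i s where "i < m" "shrikhande_adj (x i) s" "Q (x(i := s), y)" "w = (x(i := s), y)"
    | i s where "i < n" "K4_adj (y i) s" "Q (x, y(i := s))" "w = (x, y(i := s))"
      unfolding A_def B_def by blast
    then show "w \<in> ?N"
    proof cases
      case 1
      then have "w \<in> doob_vertices m n"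
        using x y by (auto simp: doob_vertices_def PiE_iff extensional_def)
      moreover have "doob_adj m n (x, y) w"
        unfolding doob_adj_def 1(4) using 1(1,2) by (auto intro!: exI[of _ i])
      ultimately show ?thesis using 1 by simp
    next
      case 2
      then have "w \<in> doob_vertices m n"
        using x y by (auto simp: doob_vertices_def PiE_iff extensional_def)
      moreover have "doob_adj m n (x, y) w"
        unfolding doob_adj_def 2(4) using 2(1,2) by (auto intro!: exI[of _ i])
      ultimately show ?thesis using 2 by simp
    qed
  qed
  moreover have "(\<Union>i<m. A i) \<inter> (\<Union>j<n. B j) = {}"
    by (auto simp: A_def B_def irrefl fun_eq_iff split: if_splits)
  moreover have "A i \<inter> A i' = {}" if "i \<noteq> i'" for i i'
  proof -
    have False if "x(i := s) = x(i' := s')" "shrikhande_adj (x i) s" for s s'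
      using fun_cong[OF that(1), of i] that(2) \<open>i \<noteq> i'\<close> irrefl by auto
    then show ?thesis by (auto simp: A_def)
  qed
  moreover have "B i \<inter> B i' = {}" if "i \<noteq> i'" for i i'
  proof -
    have False if "y(i := s) = y(i' := s')" "K4_adj (y i) s" for s s'
      using fun_cong[OF that(1), of i] that(2) \<open>i \<noteq> i'\<close> irrefl by auto
    then show ?thesis by (auto simp: B_def)
  qed
  moreover have "finite (A i)" "finite (B i)" for i
    by (auto simp: A_def B_def)
  moreover have "card (A i) = card {s. shrikhande_adj (x i) s \<and> Q (x(i := s), y)}" for i
    unfolding A_def by (rule card_image) (auto simp: inj_on_def fun_eq_iff split: if_splits)
  moreover have "card (B i) = card {s. K4_adj (y i) s \<and> Q (x, y(i := s))}" for i
    unfolding B_def by (rule card_image) (auto simp: inj_on_def fun_eq_iff split: if_splits)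
  ultimately show ?thesis
    by (simp add: card_Un_disjoint card_UN_disjoint)
qed

definition doob_coloring ::
    "('a::boolean_group \<times> 'a \<times> 'a) list \<Rightarrow> ('a \<times> 'a) list \<Rightarrow> doob_vertex \<Rightarrow> 'a" where
  "doob_coloring ts ls = (\<lambda>(x, y).
     (\<Sum>i<length ts. cross_coloring (ts ! i) (x i)) + (\<Sum>j<length ls. line_coloring (ls ! j) (y j)))"

lemma card_filter_differences:
  fixes h :: "'v::finite \<Rightarrow> 'a"
  assumes "image_mset h (mset_set {s. R s}) = M"
  shows "card {s. R s \<and> P (h s)} = size (filter_mset P M)"
proof -
  have "{s. R s \<and> P (h s)} = {s \<in> {s. R s}. P (h s)}" by auto
  then show ?thesis
    unfolding assms[symmetric] by (simp add: filter_mset_image_mset filter_mset_mset_set o_def)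
qed

lemma sum_lessThan_length: "(\<Sum>i<length xs. f (xs ! i)) = (\<Sum>x\<leftarrow>xs. f x)"
  by (simp add: sum_list_sum_nth atLeast0LessThan)

lemma size_filter_sum_list:
  "size (filter_mset P (\<Sum>x\<leftarrow>xs. f x)) = (\<Sum>x\<leftarrow>xs. size (filter_mset P (f x)))"
  by (induction xs) auto

lemma sum_fun_upd:
  fixes f :: "nat \<Rightarrow> 'b \<Rightarrow> 'a::ab_group_add"
  assumes "i < n"
  shows "(\<Sum>k<n. f k ((x(i := s)) k)) = (\<Sum>k<n. f k (x k)) + (f i s - f i (x i))"
proof -
  have "(\<Sum>k<n. f k ((x(i := s)) k)) = f i s + (\<Sum>k\<in>{..<n}-{i}. f k (x k))"
    using assms by (subst sum.remove[of _ i]) (auto intro!: sum.cong)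
  moreover have "(\<Sum>k<n. f k (x k)) = f i (x i) + (\<Sum>k\<in>{..<n}-{i}. f k (x k))"
    using assms by (subst sum.remove[of _ i]) auto
  ultimately show ?thesis by (simp add: algebra_simps)
qed

text \<open>Moving in one coordinate adds to the value an entry of the difference multiset of that
  factor, and this multiset is the same at every vertex.\<close>

lemma card_coloring_neighbours:
  fixes ts ls
  defines "V \<equiv> doob_vertices (length ts) (length ls)"
  assumes "v \<in> V"
  shows "card {w \<in> V. doob_adj (length ts) (length ls) v w \<and> P (doob_coloring ts ls w)} =
    size (filter_mset (\<lambda>d. P (doob_coloring ts ls v + d)) (total_mset ts ls))"
proof -
  obtain x y where v: "v = (x, y)" by force
  let ?\<phi> = "doob_coloring ts ls"
  have "card {s. shrikhande_adj (x i) s \<and> P (?\<phi> (x(i := s), y))} =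
      size (filter_mset (\<lambda>d. P (?\<phi> v + d)) (cross_mset (ts ! i)))" if "i < length ts" for i
  proof -
    have "?\<phi> (x(i := s), y) = ?\<phi> v + (cross_coloring (ts ! i) s - cross_coloring (ts ! i) (x i))" for s
      unfolding doob_coloring_def v
      using sum_fun_upd[OF that, of "\<lambda>k. cross_coloring (ts ! k)" x s] by (simp add: ac_simps)
    then show ?thesis
      using card_filter_differences[OF cross_coloring_differences] by simp
  qed
  moreover have "card {s. K4_adj (y i) s \<and> P (?\<phi> (x, y(i := s)))} =
      size (filter_mset (\<lambda>d. P (?\<phi> v + d)) (line_mset (ls ! i)))" if "i < length ls" for i
  proof -
    have "?\<phi> (x, y(i := s)) = ?\<phi> v + (line_coloring (ls ! i) s - line_coloring (ls ! i) (y i))" for s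
      unfolding doob_coloring_def v
      using sum_fun_upd[OF that, of "\<lambda>k. line_coloring (ls ! k)" y s] by (simp add: ac_simps)
    then show ?thesis
      using card_filter_differences[OF line_coloring_differences] by simp
  qed
  ultimately show ?thesis
    using assms card_doob_neighbours[of x y "length ts" "length ls" "\<lambda>w. P (?\<phi> w)"]
      sum_lessThan_length[of "\<lambda>t. size (filter_mset (\<lambda>d. P (?\<phi> v + d)) (cross_mset t))" ts]
      sum_lessThan_length[of "\<lambda>l. size (filter_mset (\<lambda>d. P (?\<phi> v + d)) (line_mset l))" ls]
    unfolding v total_mset_def
    by (simp add: size_filter_sum_list)
qed

section \<open>From covers of a group to perfect colorings\<close>

definition cover_mset :: "'a::boolean_group set \<Rightarrow> nat \<Rightarrow> nat \<Rightarrow> 'a multiset" where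
  "cover_mset A g a = replicate_mset a 0 + repeat_mset g (mset_set (A - {0}))"

text \<open>Translation by \<open>z\<close> permutes \<open>A\<close> and sends the nonzero elements
  to those different from \<open>z\<close>; the \<open>a\<close> zeros stay at \<open>z\<close>
  itself.\<close>

lemma size_filter_cover_mset:
  fixes A :: "'a::boolean_group set"
  assumes "finite A" "\<And>x y. x \<in> A \<Longrightarrow> y \<in> A \<Longrightarrow> x + y \<in> A" "z \<in> A"
  shows "size (filter_mset (\<lambda>d. P (z + d)) (cover_mset A g a)) =
    (if P z then a else 0) + g * card ({u \<in> A. P u} - {z})"
proof -
  have "bij_betw ((+) z) {d \<in> A - {0}. P (z + d)} ({u \<in> A. P u} - {z})"
    by (rule bij_betw_byWitness[where f' = "(+) z"]) (use assms in auto)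
  then have "card {d \<in> A - {0}. P (z + d)} = card ({u \<in> A. P u} - {z})"
    by (rule bij_betw_same_card)
  moreover have "filter_mset Q (repeat_mset n M) = repeat_mset n (filter_mset Q M)"
    for Q :: "'a \<Rightarrow> bool" and n M
    by (induction n) auto
  moreover have "size (filter_mset Q (replicate_mset n x)) = (if Q x then n else 0)"
    for Q :: "'a \<Rightarrow> bool" and n x
    by (induction n) auto
  ultimately show ?thesis
    by (simp add: cover_mset_def filter_mset_mset_set assms(1))
qed

text \<open>Lets the generators of all lines be located in \<open>A\<close> once the total multiset
  is known to lie there, so that the coloring takes its values in \<open>A\<close>.\<close>

lemma total_mset_components:
  "(x, y, w) \<in> set ts \<Longrightarrow> {x, y, w} \<subseteq> set_mset (total_mset ts ls)"
  "(p, q) \<in> set ls \<Longrightarrow> {p, q} \<subseteq> set_mset (total_mset ts ls)"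
proof -
  have "set_mset (cross_mset t) \<subseteq> set_mset (total_mset ts ls)" if "t \<in> set ts" for t
    using that by (auto simp: total_mset_def)
  then show "{x, y, w} \<subseteq> set_mset (total_mset ts ls)" if "(x, y, w) \<in> set ts"
    using that by (fastforce simp: cross_mset_def line_mset_def)
  have "set_mset (line_mset l) \<subseteq> set_mset (total_mset ts ls)" if "l \<in> set ls" for l
    using that by (auto simp: total_mset_def)
  then show "{p, q} \<subseteq> set_mset (total_mset ts ls)" if "(p, q) \<in> set ls"
    using that by (fastforce simp: line_mset_def)
qed

lemma quotient_matrix_entries [simp]:
  "quotient_matrix b c a $ 1 $ 1 = int c - int (gcd b c) + int a"
  "quotient_matrix b c a $ 1 $ 2 = int b"
  "quotient_matrix b c a $ 2 $ 1 = int c"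
  "quotient_matrix b c a $ 2 $ 2 = int b - int (gcd b c) + int a"
  by (simp_all add: quotient_matrix_def Let_def)

text \<open>The first color is the preimage of a subset \<open>T\<close> of size
  \<open>c / g\<close>. A value in \<open>T\<close> sees the other \<open>c / g - 1\<close> elements
  of \<open>T\<close> \<open>g\<close> times each and itself \<open>a\<close> times, which is the
  entry \<open>c - g + a\<close>; the other three entries arise likewise.\<close>

lemma perfect_coloring_of_cover:
  fixes A :: "'a::boolean_group set"
  assumes A: "finite A" "0 \<in> A" "\<And>x y. x \<in> A \<Longrightarrow> y \<in> A \<Longrightarrow> x + y \<in> A"
    and total: "total_mset ts ls = cover_mset A (gcd b c) a"
    and bc: "b > 0" "c > 0" "b + c = gcd b c * card A"
  shows "\<exists>f. perfect_coloring (doob_vertices (length ts) (length ls))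
    (doob_adj (length ts) (length ls)) f (quotient_matrix b c a)"
proof -
  define g where "g = gcd b c"
  let ?V = "doob_vertices (length ts) (length ls)" and ?\<phi> = "doob_coloring ts ls"
  obtain q r where q: "c = g * q" and r: "b = g * r"
    unfolding g_def by (meson dvd_def gcd_dvd1 gcd_dvd2)
  then have pos: "g > 0" "q > 0" "r > 0" using bc(1,2) by auto
  have "g * (r + q) = g * card A"
    using bc(3) unfolding g_def[symmetric] by (simp add: q r distrib_left)
  then have card_A: "card A = r + q"
    using pos(1) by simp
  then obtain T where T: "T \<subseteq> A" "card T = q"
    using obtain_subset_with_card_n[of q A] by auto
  have finT: "finite T" using T A(1) finite_subset by blast
  have card_diff: "card (A - T) = r"
    using T card_A finT by (simp add: card_Diff_subset)
  have "x \<in># repeat_mset k M \<Longrightarrow> x \<in># M" for x :: 'a and k M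
    by (induction k) auto
  then have in_A: "set_mset (total_mset ts ls) \<subseteq> A"
    unfolding total cover_mset_def using A(1,2) by (force split: if_splits)
  have comps: "{x, y, w} \<subseteq> A" if "(x, y, w) \<in> set ts" for x y w
    using that in_A total_mset_components(1) by blast
  have comps': "{p, q} \<subseteq> A" if "(p, q) \<in> set ls" for p q
    using that in_A total_mset_components(2) by blast
  have sum_A: "(\<Sum>i<n. h i) \<in> A" if "\<And>i. i < n \<Longrightarrow> h i \<in> A" for n :: nat and h
    using that by (induction n) (auto intro: A)
  have "cross_coloring t s \<in> A" if "t \<in> set ts" for t s
    using comps that by (cases t; cases s) (auto simp: cross_coloring_def intro!: A(2,3))
  moreover have "line_coloring l s \<in> A" if "l \<in> set ls" for l s
    using comps' that by (cases l) (auto simp: line_coloring_def intro!: A(2,3))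
  ultimately have \<phi>_A: "?\<phi> v \<in> A" for v
    unfolding doob_coloring_def by (cases v) (simp add: A(3) sum_A)
  define f :: "doob_vertex \<Rightarrow> 2" where "f v = (if ?\<phi> v \<in> T then 1 else 2)" for v
  have f_eq: "f v = 1 \<longleftrightarrow> ?\<phi> v \<in> T" "f v = 2 \<longleftrightarrow> ?\<phi> v \<notin> T" for v
    by (simp_all add: f_def)
  have count: "int (card {w \<in> ?V. doob_adj (length ts) (length ls) v w \<and> f w = j}) =
      quotient_matrix b c a $ f v $ j" if v: "v \<in> ?V" for v j
  proof -
    have card_eq: "card {w \<in> ?V. doob_adj (length ts) (length ls) v w \<and> P (?\<phi> w)} =
        (if P (?\<phi> v) then a else 0) + g * card ({u \<in> A. P u} - {?\<phi> v})" for P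
      using card_coloring_neighbours[OF v] total size_filter_cover_mset[OF A(1,3) \<phi>_A]
      by (simp add: g_def)
    have sets: "{u \<in> A. u \<in> T} = T" "{u \<in> A. u \<notin> T} = A - T" using T by auto
    have "card {w \<in> ?V. doob_adj (length ts) (length ls) v w \<and> f w = 1} =
        (if ?\<phi> v \<in> T then a + g * (q - 1) else g * q)"
      using card_eq[of "\<lambda>u. u \<in> T"] T(2) by (simp only: f_eq sets) simp
    moreover have "card {w \<in> ?V. doob_adj (length ts) (length ls) v w \<and> f w = 2} =
        (if ?\<phi> v \<in> T then g * r else a + g * (r - 1))"
      using card_eq[of "\<lambda>u. u \<notin> T"] card_diff \<phi>_A[of v] by (simp only: f_eq sets) simp
    \<comment> \<open>The truncated subtractions are exact because \<open>q\<close> and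
      \<open>r\<close> are positive.\<close>
    moreover have "int (g * (q - 1)) = int c - int g" "int (g * (r - 1)) = int b - int g"
      using pos by (simp_all add: q r of_nat_diff right_diff_distrib)
    moreover note quotient_matrix_entries[of b c a, folded g_def]
    ultimately show ?thesis
      using exhaust_2[of j] f_eq[of v] q r by (cases "?\<phi> v \<in> T") (elim disjE; simp)+
  qed
  have "f ` ?V = UNIV"
  proof -
    have "?V \<noteq> {}" by (auto simp: doob_vertices_def PiE_eq_empty_iff)
    then obtain v where v: "v \<in> ?V" by blast
    \<comment> \<open>The off-diagonal entries \<open>b\<close> and \<open>c\<close> are positive,
      so any vertex has a neighbour of the other color; this gives surjectivity.\<close>
    have "card {w \<in> ?V. doob_adj (length ts) (length ls) v w \<and> f w = j} > 0" if "j \<noteq> f v" for j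
    proof -
      have "quotient_matrix b c a $ f v $ j > 0"
        using exhaust_2[of j] exhaust_2[of "f v"]
        by (elim disjE) (use that bc(1,2) in simp_all)
      then show ?thesis using count[OF v, of j] by linarith
    qed
    then have "\<exists>w\<in>?V. j = f w" for j
      using v by (cases "j = f v") (auto simp: card_gt_0_iff)
    then show ?thesis by (auto simp: set_eq_iff image_iff)
  qed
  then show ?thesis
    using count unfolding perfect_coloring_def by blast
qed

section \<open>Binary vectors as a model of elementary abelian 2-groups\<close>

type_synonym bitvec = "nat \<Rightarrow> bit"

text \<open>All dimensions live as nested subgroups of one type, so that induction can change the
  dimension without changing the type.\<close>

definition bits_below :: "nat \<Rightarrow> bitvec set" where
  "bits_below k = {f. \<forall>i\<ge>k. f i = 0}"

definition unit_bit :: "nat \<Rightarrow> bitvec" where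
  "unit_bit k = (\<lambda>i. if i = k then 1 else 0)"

lemma zero_bits_below [simp]: "0 \<in> bits_below k"
  by (simp add: bits_below_def)

lemma add_bits_below: "x \<in> bits_below k \<Longrightarrow> y \<in> bits_below k \<Longrightarrow> x + y \<in> bits_below k"
  by (simp add: bits_below_def)

lemma unit_bit_bits_below [simp]: "unit_bit i \<in> bits_below k \<longleftrightarrow> i < k"
  by (auto simp: bits_below_def unit_bit_def not_le split: if_splits)

lemma bits_below_mono: "j \<le> k \<Longrightarrow> bits_below j \<subseteq> bits_below k"
  by (auto simp: bits_below_def)

lemma bits_below_0: "bits_below 0 = {0}"
  by (auto simp: bits_below_def fun_eq_iff)

lemma bits_below_Suc: "bits_below (Suc k) = bits_below k \<union> (+) (unit_bit k) ` bits_below k"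
proof (intro set_eqI iffI)
  fix x assume x: "x \<in> bits_below (Suc k)"
  show "x \<in> bits_below k \<union> (+) (unit_bit k) ` bits_below k"
  proof (cases "x k = 0")
    case True
    then have "x \<in> bits_below k"
      using x by (auto simp: bits_below_def) (metis Suc_leI le_neq_implies_less)
    then show ?thesis ..
  next
    case False
    then have "unit_bit k + x \<in> bits_below k"
      using x by (auto simp: bits_below_def unit_bit_def)
    moreover have "x = unit_bit k + (unit_bit k + x)" by simp
    ultimately show ?thesis by blast
  qed
next
  fix x assume "x \<in> bits_below k \<union> (+) (unit_bit k) ` bits_below k"
  then show "x \<in> bits_below (Suc k)"
    using bits_below_mono[of k "Suc k"] by (auto intro!: add_bits_below)
qed

lemma bits_below_Suc_disjoint: "bits_below k \<inter> (+) (unit_bit k) ` bits_below k = {}"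
proof -
  have "x k = 0" "(unit_bit k + x) k = 1" if "x \<in> bits_below k" for x
    using that by (simp_all add: bits_below_def unit_bit_def)
  then have "unit_bit k + y \<notin> bits_below k" if "y \<in> bits_below k" for y
    using that by (metis zero_neq_one)
  then show ?thesis by blast
qed

lemma finite_bits_below [simp]: "finite (bits_below k)"
  by (induction k) (auto simp: bits_below_0 bits_below_Suc)

lemma card_bits_below: "card (bits_below k) = 2 ^ k"
  by (induction k)
     (auto simp: bits_below_0 bits_below_Suc card_Un_disjoint bits_below_Suc_disjoint card_image)

lemma image_mset_add_comp: "image_mset (\<lambda>z. s + h z) M = image_mset ((+) s) (image_mset h M)"
  by (simp only: multiset.map_comp o_def)

lemma mset_bits_below_Suc:
  "mset_set (bits_below (Suc k)) = mset_set (bits_below k) + image_mset ((+) (unit_bit k)) (mset_set (bits_below k))"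
  by (simp add: bits_below_Suc mset_set_Union bits_below_Suc_disjoint image_mset_mset_set)

text \<open>The right-hand side lists the three nontrivial cosets of \<open>bits_below k\<close> in
  \<open>bits_below (k + 2)\<close>.\<close>

lemma mset_bits_below_add_2:
  "mset_set (bits_below (k + 2) - bits_below k) =
    image_mset ((+) (unit_bit k)) (mset_set (bits_below k)) +
    image_mset ((+) (unit_bit (Suc k))) (mset_set (bits_below k)) +
    image_mset ((+) (unit_bit k + unit_bit (Suc k))) (mset_set (bits_below k))"
proof -
  have "mset_set (bits_below (k + 2)) =
      mset_set (bits_below k) + image_mset ((+) (unit_bit k)) (mset_set (bits_below k)) +
      (image_mset ((+) (unit_bit (Suc k))) (mset_set (bits_below k)) +
       image_mset (\<lambda>z. unit_bit (Suc k) + (unit_bit k + z)) (mset_set (bits_below k)))"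
    using image_mset_add_comp[of "unit_bit (Suc k)" "(+) (unit_bit k)"]
    by (simp add: mset_bits_below_Suc)
  moreover have "image_mset (\<lambda>z. unit_bit (Suc k) + (unit_bit k + z)) (mset_set (bits_below k)) =
      image_mset ((+) (unit_bit k + unit_bit (Suc k))) (mset_set (bits_below k))"
    by (rule image_mset_cong) (simp only: ac_simps)
  ultimately show ?thesis
    using bits_below_mono[of k "k + 2"] by (simp add: mset_set_Diff)
qed

lemma mset_bits_below_3:
  defines "a \<equiv> unit_bit 0" and "b \<equiv> unit_bit 1" and "c \<equiv> unit_bit 2"
  shows "mset_set (bits_below 3 - {0}) = {#a, b, c, a + b, a + c, b + c, a + (b + c)#}"
proof -
  have "mset_set (bits_below 3) = {#0, a, b, c, a + b, a + c, b + c, a + (b + c)#}"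
    unfolding a_def b_def c_def
    by (simp add: numeral_3_eq_3 mset_bits_below_Suc bits_below_0 numeral_2_eq_2 add_mset_commute add.commute add.left_commute)
  then show ?thesis by (simp add: mset_set_Diff)
qed

lemma total_mset_simps [simp]:
  "total_mset [] [] = {#}"
  "total_mset ((x, y, w) # ts) ls = {#x, y, x + y, x, w, x + w#} + total_mset ts ls"
  "total_mset [] ((p, q) # ls) = {#p, q, p + q#} + total_mset [] ls"
  by (simp_all only: total_mset_def cross_mset_def line_mset_def list.map sum_list.Nil sum_list.Cons
      prod.case add_0_left add_0_right add.assoc union_mset_add_mset_left)

lemma total_mset_append:
  "total_mset (ts @ ts') (ls @ ls') = total_mset ts ls + total_mset ts' ls'"
  by (simp add: total_mset_def)

lemma cover_mset_add:
  fixes A :: "'a::boolean_group set"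
  shows "cover_mset A (g + g') (a + a') = cover_mset A g a + cover_mset A g' a'"
proof -
  have "replicate_mset (m + n) x = replicate_mset m x + replicate_mset n x" for m n and x :: 'a
    by (induction m) auto
  then show ?thesis by (simp add: cover_mset_def)
qed

section \<open>Explicit covers in dimension three\<close>

text \<open>Numerals are unfolded into single copies; then ordered rewriting, with cancellation of
  equal summands, sorts both multisets into one normal form.\<close>

lemmas explicit_mset_simps = total_mset_simps eval_nat_numeral BitM.simps One_nat_def
  replicate_mset_Suc replicate_mset_0 repeat_mset_Suc repeat_mset_0 union_mset_add_mset_left
  union_mset_add_mset_right add_mset_commute ac_simps add_self add_left_self add_0_left add_0_right

text \<open>The third cover takes each of the seven Fano lines twice, the fourth takes each once.
  The first two take the four lines avoiding \<open>a\<close> once or twice and supply the missing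
  copies of \<open>a\<close> by degenerate lines with zeros. The fifth takes the three lines through
  \<open>a\<close>, a degenerate line at one further point of each, and twice the line
  \<open>b, c, b + c\<close>.\<close>

lemma explicit_covers:
  fixes a b c :: "'a::boolean_group"
  defines "B \<equiv> {#a, b, c, a + b, a + c, b + c, a + (b + c)#}"
  shows
    "total_mset [(b, c, a + c), (a + b, c, b + c), (0, a, 0)] [] = replicate_mset 4 0 + repeat_mset 2 B"
    "total_mset [(b, c, c), (b, a + c, a + c), (c, a + b, a + b), (a + b, b + c, b + c), (a, 0, 0)] [] =
      replicate_mset 2 0 + repeat_mset 4 B"
    "total_mset [(a, b, b), (a, c, c), (b, c, c), (a, b + c, b + c), (b, a + c, a + c), (c, a + b, a + b),
      (a + b, b + c, b + c)] [] = replicate_mset 0 0 + repeat_mset 6 B"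
    "total_mset [(a, b, c), (b, c, a + c), (a + b, c, b + c)] [(a, b + c)] = replicate_mset 0 0 + repeat_mset 3 B"
    "total_mset [(a + b, a, 0), (a + c, a, 0), (a + (b + c), a, 0), (b, c, c)] [] =
      replicate_mset 3 0 + repeat_mset 3 B"
  unfolding B_def by (simp_all only: explicit_mset_simps)

text \<open>Each step adds the zero-free cover of multiplicity 6, so only the residue of
  \<open>t\<close> modulo 3 matters. A list of crosses has size divisible by 6, and \<open>a\<close>
  is the least number of zeros that brings \<open>14 * t\<close> to a multiple of 6.\<close>

lemma even_cover_bits_below_3:
  "\<exists>ts. total_mset ts [] =
    cover_mset (bits_below 3) (2 * t) (if t mod 3 = 0 then 0 else if t mod 3 = 2 then 2 else 4)"
proof (induction t rule: less_induct)
  case (less t)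
  note covers = explicit_covers[where a = "unit_bit 0" and b = "unit_bit 1" and c = "unit_bit 2",
    folded mset_bits_below_3 cover_mset_def]
  consider "t = 0" | "t = 1" | "t = 2" | "t \<ge> 3" by linarith
  then show ?case
  proof cases
    case 1
    have "total_mset [] [] = cover_mset (bits_below 3) (2 * t) 0"
      unfolding 1 by (simp add: cover_mset_def)
    with 1 show ?thesis by (intro exI[of _ "[]"]) simp
  next
    case 2
    have "\<exists>ts. total_mset ts [] = cover_mset (bits_below 3) 2 4" using covers(1) by blast
    with 2 show ?thesis by simp
  next
    case 3
    have "\<exists>ts. total_mset ts [] = cover_mset (bits_below 3) 4 2" using covers(2) by blast
    with 3 show ?thesis by simp
  next
    case 4
    then have "2 * t = 6 + 2 * (t - 3)" "(t - 3) mod 3 = t mod 3"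
      by (auto simp: le_mod_geq)
    moreover obtain ts where "total_mset ts [] = cover_mset (bits_below 3) (2 * (t - 3))
        (if (t - 3) mod 3 = 0 then 0 else if (t - 3) mod 3 = 2 then 2 else 4)"
      using less.IH[of "t - 3"] 4 by auto
    ultimately show ?thesis
      using covers(3) total_mset_append[of _ ts "[]" "[]"]
        cover_mset_add[of "bits_below 3 :: bitvec set" 6 "2 * (t - 3)" 0]
      by (metis add_0 append_Nil)
  qed
qed

text \<open>Three copies of seven points have size 21, not a multiple of 6: either one single line
  is left over, or three zeros are added.\<close>

lemma threefold_cover_bits_below_3:
  "\<exists>ts l. total_mset ts [l] = cover_mset (bits_below 3) 3 0"
  "\<exists>ts. total_mset ts [] = cover_mset (bits_below 3) 3 3"
proof -
  note covers = explicit_covers[where a = "unit_bit 0" and b = "unit_bit 1" and c = "unit_bit 2",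
    folded mset_bits_below_3 cover_mset_def]
  show "\<exists>ts l. total_mset ts [l] = cover_mset (bits_below 3) 3 0"
    "\<exists>ts. total_mset ts [] = cover_mset (bits_below 3) 3 3"
    using covers(4,5) by blast+
qed

section \<open>A linear orthomorphism in odd dimension\<close>

text \<open>
  In odd dimension this is multiplication by a generator of the field of order 8 on the first three bits
  and by a generator of the field of order 4 on each following pair of bits \<open>(3,4), (5,6), \<dots>\<close>
  Hence both the map and its sum with the identity are injective.
\<close>

definition orthomorphism :: "(nat \<Rightarrow> 'a::boolean_group) \<Rightarrow> nat \<Rightarrow> 'a" where
  "orthomorphism f = (\<lambda>i. if i = 0 then f 2 else if i = 1 then f 0 + f 2 else if i = 2 then f 1
     else if odd i then f (i + 1) else f (i - 1) + f i)"

lemma orthomorphism_add: "orthomorphism (x + y) = orthomorphism x + orthomorphism y"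
  by (rule ext) (simp add: orthomorphism_def ac_simps)

lemma orthomorphism_bits_below:
  assumes "odd k" "k \<ge> 3" "f \<in> bits_below k"
  shows "orthomorphism f \<in> bits_below k"
  unfolding bits_below_def
proof (intro CollectI allI impI)
  fix i assume "k \<le> i"
  then have "f i = 0" "f (i + 1) = 0" using assms by (auto simp: bits_below_def)
  \<comment> \<open>As \<open>k\<close> is odd, no pair of bits straddles the bound: an even
    \<open>i\<close> above it has \<open>i - 1\<close> at least \<open>k\<close> too.\<close>
  moreover have "f (i - 1) = 0" if "even i"
  proof -
    have "k \<noteq> i" using that assms(1) by auto
    then show ?thesis using \<open>k \<le> i\<close> assms by (auto simp: bits_below_def)
  qed
  ultimately show "orthomorphism f i = 0"
    using \<open>k \<le> i\<close> assms by (auto simp: orthomorphism_def)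
qed

lemma nat_small_or_parity_cases:
  "i = 0 \<or> i = 1 \<or> i = 2 \<or> (i \<ge> 3 \<and> odd i) \<or> (i \<ge> 4 \<and> even i)" for i :: nat
  by presburger

lemma orthomorphism_kernel:
  assumes "orthomorphism f = 0"
  shows "f = 0"
proof
  have *: "orthomorphism f i = 0" for i using assms by simp
  fix i :: nat
  consider "i = 0" | "i = 1" | "i = 2" | "i \<ge> 3" "odd i" | "i \<ge> 4" "even i"
    using nat_small_or_parity_cases[of i] by blast
  then show "f i = 0 i"
  proof cases
    case 4
    \<comment> \<open>Within a pair, the odd output bit gives \<open>f (i + 1) = 0\<close> and the
      even one then gives \<open>f i = 0\<close>.\<close>
    then show ?thesis using *[of i] *[of "Suc i"] by (auto simp: orthomorphism_def)
  next
    case 5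
    then show ?thesis using *[of "i - 1"] by (auto simp: orthomorphism_def split: if_splits)
  qed (use *[of 0] *[of 1] *[of 2] in \<open>auto simp: orthomorphism_def\<close>)
qed

lemma add_orthomorphism_kernel:
  assumes "f + orthomorphism f = 0"
  shows "f = 0"
proof
  have *: "f i + orthomorphism f i = 0" for i using assms by (metis plus_fun_apply zero_fun_apply)
  fix i :: nat
  consider "i = 0" | "i = 1" | "i = 2" | "i \<ge> 3" "odd i" | "i \<ge> 4" "even i"
    using nat_small_or_parity_cases[of i] by blast
  then show "f i = 0 i"
  proof cases
    case 4
    then show ?thesis using *[of "Suc i"] by (auto simp: orthomorphism_def)
  next
    case 5
    then show ?thesis using *[of i] *[of "i - 1"]
      by (auto simp: orthomorphism_def split: if_splits)
  qed (use *[of 0] *[of 1] *[of 2] in \<open>auto simp: orthomorphism_def\<close>)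
qed

text \<open>An additive map with trivial kernel is injective, hence a permutation of the finite
  subgroup.\<close>

lemma image_mset_additive_bits_below:
  assumes "\<And>x. x \<in> bits_below k \<Longrightarrow> h x \<in> bits_below k"
    and "\<And>x y. h (x + y) = h x + h y" and "\<And>x. h x = 0 \<Longrightarrow> x = 0"
  shows "image_mset h (mset_set (bits_below k)) = mset_set (bits_below k)"
proof -
  have "inj_on h (bits_below k)"
  proof (rule inj_onI)
    fix x y assume "h x = h y"
    then have "h (x + y) = 0" unfolding assms(2) by simp
    then show "x = y" using assms(3)[of "x + y"] by simp
  qed
  then show ?thesis
    using assms(1) by (simp add: image_mset_mset_set endo_inj_surj image_subsetI)
qed

lemma image_mset_orthomorphism:
  assumes "odd k" "k \<ge> 3"
  shows "image_mset orthomorphism (mset_set (bits_below k)) = mset_set (bits_below k)"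
    and "image_mset (\<lambda>z. z + orthomorphism z) (mset_set (bits_below k)) = mset_set (bits_below k)"
proof -
  show "image_mset orthomorphism (mset_set (bits_below k)) = mset_set (bits_below k)"
    using orthomorphism_bits_below[OF assms] orthomorphism_add orthomorphism_kernel
    by (rule image_mset_additive_bits_below)
  have "z + orthomorphism z \<in> bits_below k" if "z \<in> bits_below k" for z
    using that orthomorphism_bits_below[OF assms] by (intro add_bits_below)
  moreover have "(x + y) + orthomorphism (x + y) = (x + orthomorphism x) + (y + orthomorphism y)"
    for x y :: bitvec
    by (simp only: orthomorphism_add ac_simps)
  ultimately show "image_mset (\<lambda>z. z + orthomorphism z) (mset_set (bits_below k)) = mset_set (bits_below k)"
    using add_orthomorphism_kernel by (rule image_mset_additive_bits_below)
qed

lemma image_mset_add_bits_below: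
  assumes "e \<in> bits_below k"
  shows "image_mset ((+) e) (mset_set (bits_below k)) = mset_set (bits_below k)"
proof -
  have "(+) e ` bits_below k = bits_below k"
    by (rule endo_inj_surj) (auto intro: add_bits_below assms)
  then show ?thesis by (simp add: image_mset_mset_set)
qed

section \<open>Extension by two dimensions\<close>

lemma total_mset_map:
  "total_mset (map (\<lambda>z. (x z, y z, w z)) zs) [] =
    image_mset x (mset zs) + image_mset x (mset zs) + image_mset y (mset zs) + image_mset w (mset zs) +
    image_mset (\<lambda>z. x z + y z) (mset zs) + image_mset (\<lambda>z. x z + w z) (mset zs)"
  by (induction zs) (simp_all only: list.map total_mset_simps mset.simps image_mset_empty image_mset_add_mset
    union_mset_add_mset_left union_mset_add_mset_right add_0_left add_mset_commute ac_simps)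

text \<open>The lines \<open>X z, Y z, Z z\<close> meet each of the three new cosets once. Since
  \<open>orthomorphism\<close> and its sum with the identity are bijective, these lines partition
  the cosets; a cross with equal arms uses each line twice.\<close>

lemma twofold_cover_step:
  assumes "odd k" "k \<ge> 3"
  shows "\<exists>ts. total_mset ts [] = repeat_mset 2 (mset_set (bits_below (k + 2) - bits_below k))"
proof -
  let ?\<sigma> = orthomorphism and ?\<alpha> = "unit_bit k" and ?\<beta> = "unit_bit (Suc k)"
  let ?V = "mset_set (bits_below k)"
  obtain zs where zs: "mset zs = ?V" using ex_mset by blast
  define X where "X z = ?\<alpha> + ?\<sigma> z" for z
  define Y where "Y z = ?\<beta> + z" for z
  define Z where "Z z = ?\<alpha> + ?\<beta> + (z + ?\<sigma> z)" for z
  have sum: "X z + Y z = Z z" for z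
    unfolding X_def Y_def Z_def by (simp only: ac_simps)
  have X: "image_mset X ?V = image_mset ((+) ?\<alpha>) ?V"
    unfolding X_def image_mset_add_comp[of _ ?\<sigma>] image_mset_orthomorphism[OF assms] ..
  have Y: "image_mset Y ?V = image_mset ((+) ?\<beta>) ?V"
    unfolding Y_def ..
  have Z: "image_mset Z ?V = image_mset ((+) (?\<alpha> + ?\<beta>)) ?V"
    unfolding Z_def image_mset_add_comp[of _ "\<lambda>z. z + ?\<sigma> z"] image_mset_orthomorphism[OF assms] ..
  have "total_mset (map (\<lambda>z. (X z, Y z, Y z)) zs) [] =
      repeat_mset 2 (mset_set (bits_below (k + 2) - bits_below k))"
    unfolding mset_bits_below_add_2 total_mset_map zs sum X Y Z
    by (simp only: numeral_2_eq_2 One_nat_def repeat_mset_Suc repeat_mset_0 add_0_left add_0_right ac_simps)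
  then show ?thesis by blast
qed

text \<open>
  The lines are \<open>X z, Y z, Z z\<close> (twice) and \<open>X z, Y (e + z), Z' z\<close> (once). Pairing lines with a common
  point uses the classes \<open>{z, e + z}\<close>, represented by \<open>H\<close>: each class has six lines, forming three pairs.
\<close>

lemma threefold_cover_step:
  assumes "odd k" "k \<ge> 3"
  shows "\<exists>ts. total_mset ts [] = repeat_mset 3 (mset_set (bits_below (k + 2) - bits_below k))"
proof -
  let ?\<sigma> = orthomorphism and ?\<alpha> = "unit_bit k" and ?\<beta> = "unit_bit (Suc k)" and ?e = "unit_bit 0"
  let ?V = "mset_set (bits_below k)"
  define H where "H = {z \<in> bits_below k. z 0 = 0}"
  \<comment> \<open>\<open>H\<close> is the hyperplane where bit 0 vanishes, and adding
    \<open>?e\<close> flips this bit, so \<open>H\<close> and its translate partition the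
    space.\<close>
  have "bits_below k = H \<union> (+) ?e ` H"
  proof (intro set_eqI iffI)
    fix z assume z: "z \<in> bits_below k"
    show "z \<in> H \<union> (+) ?e ` H"
    proof (cases "z 0 = 0")
      case False
      then have "?e + z \<in> H"
        using z assms by (auto simp: H_def unit_bit_def bits_below_def)
      then have "?e + (?e + z) \<in> (+) ?e ` H" by (rule imageI)
      then show ?thesis by (intro UnI2) (simp only: add_left_self)
    qed (use z in \<open>auto simp: H_def\<close>)
  next
    fix z assume "z \<in> H \<union> (+) ?e ` H"
    moreover have "?e + z \<in> bits_below k" if "z \<in> bits_below k" for z
      using that assms by (intro add_bits_below) simp_all
    ultimately show "z \<in> bits_below k" unfolding H_def by blast
  qed
  moreover have "H \<inter> (+) ?e ` H = {}"
  proof -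
    have "?e + z \<notin> H" if "z \<in> H" for z
      using that by (simp add: H_def unit_bit_def)
    then show ?thesis by blast
  qed
  moreover have "finite H" by (simp add: H_def)
  ultimately have V: "?V = mset_set H + image_mset ((+) ?e) (mset_set H)"
    by (simp add: mset_set_Union image_mset_mset_set)
  have split: "image_mset h (mset_set H) + image_mset (\<lambda>z. h (?e + z)) (mset_set H) = image_mset h ?V"
    for h :: "bitvec \<Rightarrow> bitvec"
    unfolding V image_mset_union multiset.map_comp o_def ..
  obtain zs where zs: "mset zs = mset_set H" using ex_mset by blast
  define X where "X z = ?\<alpha> + ?\<sigma> z" for z
  define Y where "Y z = ?\<beta> + z" for z
  define Z where "Z z = ?\<alpha> + ?\<beta> + (z + ?\<sigma> z)" for z
  define Z' where "Z' z = ?\<alpha> + ?\<beta> + (?e + (z + ?\<sigma> z))" for z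
  have sums: "X z + Y z = Z z" "Y z + X z = Z z" "X z + Y (?e + z) = Z' z"
    "Y z + X (?e + z) = Z' (?e + z)" for z
    unfolding X_def Y_def Z_def Z'_def by (simp_all only: ac_simps add_left_self)
  have X: "image_mset X ?V = image_mset ((+) ?\<alpha>) ?V"
    unfolding X_def image_mset_add_comp[of _ ?\<sigma>] image_mset_orthomorphism[OF assms] ..
  have Z: "image_mset Z ?V = image_mset ((+) (?\<alpha> + ?\<beta>)) ?V"
    unfolding Z_def image_mset_add_comp[of _ "\<lambda>z. z + ?\<sigma> z"] image_mset_orthomorphism[OF assms] ..
  have Y: "image_mset Y ?V = image_mset ((+) ?\<beta>) ?V"
    unfolding Y_def ..
  have "?e \<in> bits_below k" using assms by simp
  then have Z': "image_mset Z' ?V = image_mset ((+) (?\<alpha> + ?\<beta>)) ?V"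
    unfolding Z'_def image_mset_add_comp[of _ "\<lambda>z. ?e + (z + ?\<sigma> z)"] image_mset_add_comp[of ?e "\<lambda>z. z + ?\<sigma> z"]
      image_mset_orthomorphism[OF assms] by (simp only: image_mset_add_bits_below)
  \<comment> \<open>For a class \<open>{z, e + z}\<close>, the first two crosses use the line
    \<open>X z, Y z, Z z\<close> twice and both shifted lines once; the third doubles the unshifted
    line at \<open>e + z\<close>.\<close>
  let ?ts = "map (\<lambda>z. (X z, Y z, Y (?e + z))) zs @ map (\<lambda>z. (Y z, X z, X (?e + z))) zs @
    map (\<lambda>z. (X (?e + z), Y (?e + z), Y (?e + z))) zs"
  have "total_mset ?ts [] =
      repeat_mset 3 (image_mset X ?V) + repeat_mset 3 (image_mset Y ?V) +
      repeat_mset 2 (image_mset Z ?V) + image_mset Z' ?V"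
    by (simp only: total_mset_append[of _ _ "[]" "[]", unfolded append_Nil] total_mset_map zs sums)
       (simp only: split[symmetric] eval_nat_numeral BitM.simps One_nat_def
        repeat_mset_Suc repeat_mset_0 add_0_left add_0_right ac_simps)
  also have "\<dots> = repeat_mset 3 (mset_set (bits_below (k + 2) - bits_below k))"
    unfolding mset_bits_below_add_2 X Y Z Z'
    by (simp only: eval_nat_numeral BitM.simps One_nat_def repeat_mset_Suc repeat_mset_0 add_0_left add_0_right ac_simps)
  finally show ?thesis by blast
qed

text \<open>The successive differences from dimension 3 up to \<open>k\<close> are disjoint, so
  their covers are concatenated.\<close>

lemma cover_outside_bits_below_3:
  assumes step: "\<And>k. odd k \<Longrightarrow> k \<ge> 3 \<Longrightarrow>
      \<exists>ts. total_mset ts [] = repeat_mset r (mset_set (bits_below (k + 2) - bits_below k))"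
    and "odd k" "k \<ge> 3"
  shows "\<exists>ts. total_mset ts [] = repeat_mset r (mset_set (bits_below k - bits_below 3))"
  using assms(2,3)
proof (induction k rule: less_induct)
  case (less k)
  show ?case
  proof (cases "k = 3")
    case True
    then show ?thesis by (intro exI[of _ "[]"]) simp
  next
    case False
    define j where "j = k - 2"
    have j: "odd j" "j \<ge> 3" "k = j + 2" "j < k"
      using False less.prems by (auto simp: j_def) presburger
    obtain ts ts' where "total_mset ts [] = repeat_mset r (mset_set (bits_below j - bits_below 3))"
      "total_mset ts' [] = repeat_mset r (mset_set (bits_below k - bits_below j))"
      using less.IH[of j] step[of j] j by blast
    moreover have "bits_below k - bits_below 3 = (bits_below j - bits_below 3) \<union> (bits_below k - bits_below j)"
      using bits_below_mono[of 3 j] bits_below_mono[of j k] j by auto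
    moreover have "(bits_below j - bits_below 3) \<inter> (bits_below k - bits_below j) = {}" by auto
    ultimately show ?thesis
      using total_mset_append[of ts ts' "[]" "[]"]
      by (intro exI[of _ "ts @ ts'"]) (simp add: mset_set_Union)
  qed
qed

section \<open>Covers in every odd dimension\<close>

text \<open>All zeros are accounted for in dimension three, so the value of \<open>a\<close> is
  decided there.\<close>

lemma cover_mset_bits_below:
  assumes "k \<ge> 3"
  shows "cover_mset (bits_below k) g a =
    cover_mset (bits_below 3) g a + repeat_mset g (mset_set (bits_below k - bits_below 3))"
proof -
  have "bits_below k - {0} = (bits_below 3 - {0}) \<union> (bits_below k - bits_below 3)"
    using bits_below_mono[OF assms] by auto
  moreover have "(bits_below 3 - {0}) \<inter> (bits_below k - bits_below 3) = {}" by auto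
  ultimately show ?thesis
    by (simp add: cover_mset_def mset_set_Union)
qed

lemma even_cover:
  assumes "odd k" "k \<ge> 3"
  shows "\<exists>ts. total_mset ts [] =
    cover_mset (bits_below k) (2 * t) (if t mod 3 = 0 then 0 else if t mod 3 = 2 then 2 else 4)"
proof -
  obtain ts where ts: "total_mset ts [] = repeat_mset 2 (mset_set (bits_below k - bits_below 3))"
    using cover_outside_bits_below_3[OF twofold_cover_step assms] by blast
  have "\<exists>ts. total_mset ts [] = repeat_mset (2 * t) (mset_set (bits_below k - bits_below 3))"
  proof (induction t)
    case 0
    show ?case by (intro exI[of _ "[]"]) simp
  next
    case (Suc t)
    then obtain us where "total_mset us [] = repeat_mset (2 * t) (mset_set (bits_below k - bits_below 3))"
      by blast
    then show ?case
      using ts total_mset_append[of ts us "[]" "[]"]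
      by (intro exI[of _ "ts @ us"]) (simp add: left_diff_repeat_mset_distrib' numeral_2_eq_2)
  qed
  moreover obtain vs where "total_mset vs [] =
      cover_mset (bits_below 3) (2 * t) (if t mod 3 = 0 then 0 else if t mod 3 = 2 then 2 else 4)"
    using even_cover_bits_below_3 by blast
  ultimately show ?thesis
    unfolding cover_mset_bits_below[OF assms(2)]
    using total_mset_append[of _ _ "[]" "[]"] by (metis append_Nil)
qed

text \<open>An odd multiplicity is 3 plus an even one: the threefold cover is extended outward, then
  an even cover is added, and the zeros add up.\<close>

lemma extend_threefold_cover:
  assumes "odd k" "k \<ge> 3" and "total_mset ts ls = cover_mset (bits_below 3) 3 a"
  shows "\<exists>ts. total_mset ts ls = cover_mset (bits_below k) (3 + 2 * t)
    ((if t mod 3 = 0 then 0 else if t mod 3 = 2 then 2 else 4) + a)"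
proof -
  obtain us where us: "total_mset us [] = repeat_mset 3 (mset_set (bits_below k - bits_below 3))"
    using cover_outside_bits_below_3[OF threefold_cover_step assms(1,2)] by blast
  obtain vs where vs: "total_mset vs [] =
      cover_mset (bits_below k) (2 * t) (if t mod 3 = 0 then 0 else if t mod 3 = 2 then 2 else 4)"
    using even_cover[OF assms(1,2)] by blast
  have "total_mset (ts @ us) ls = cover_mset (bits_below k) 3 a"
    using total_mset_append[of ts us ls "[]"] us assms(3) cover_mset_bits_below[OF assms(2)] by simp
  then have "total_mset ((ts @ us) @ vs) ls = cover_mset (bits_below k) (3 + 2 * t)
      ((if t mod 3 = 0 then 0 else if t mod 3 = 2 then 2 else 4) + a)"
    using total_mset_append[of "ts @ us" vs ls "[]"] vs
    by (subst add.commute[of _ a]) (simp only: cover_mset_add append_Nil2)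
  then show ?thesis by blast
qed

section \<open>Distribution over the factors of \<open>D(m,n)\<close>\<close>

lemma size_total_mset: "size (total_mset ts ls) = 3 * (2 * length ts + length ls)"
proof -
  have "size (\<Sum>t\<leftarrow>ts. cross_mset t) = 6 * length ts"
    by (induction ts) (auto simp: cross_mset_def line_mset_def)
  moreover have "size (\<Sum>l\<leftarrow>ls. line_mset l) = 3 * length ls"
    by (induction ls) (auto simp: line_mset_def)
  ultimately show ?thesis by (simp add: total_mset_def)
qed

lemma size_cover_mset: "size (cover_mset (bits_below k) g a) = g * (2 ^ k - 1) + a"
  by (simp add: cover_mset_def card_bits_below)

text \<open>A cross is the sum of its two lines, so a Shrikhande factor may be traded for two
  factors \<open>K4\<close> without changing the total.\<close>

lemma split_crosses:
  fixes ts :: "('a::boolean_group \<times> 'a \<times> 'a) list"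
  assumes "m \<le> length ts"
  shows "\<exists>ts' ls'. length ts' = m \<and> length ls' = 2 * (length ts - m) + length ls \<and>
    total_mset ts' ls' = total_mset ts ls"
proof -
  let ?us = "drop m ts"
  let ?ls = "map (\<lambda>(x, y, w). (x, y)) ?us @ map (\<lambda>(x, y, w). (x, w)) ?us"
  have "total_mset [] (map (\<lambda>(x, y, w). (x, y)) us @ map (\<lambda>(x, y, w). (x, w)) us) = total_mset us []"
    for us :: "('a \<times> 'a \<times> 'a) list"
    by (induction us) (auto simp: total_mset_def cross_mset_def)
  then have "total_mset (take m ts) (?ls @ ls) = total_mset ts ls"
    using total_mset_append[of "take m ts" "[]" "[]" "?ls @ ls"] total_mset_append[of "[]" "[]" ?ls ls]
      total_mset_append[of "take m ts" ?us "[]" "[]"] total_mset_append[of ts "[]" "[]" ls]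
    by (simp add: ac_simps del: map_append)
  then show ?thesis using assms by (intro exI[of _ "take m ts"] exI[of _ "?ls @ ls"]) simp
qed

lemma perfect_coloring_of_bits_cover:
  assumes total: "total_mset ts ls = cover_mset (bits_below k) g a"
    and "length ls \<le> 1"
    and bc: "g = gcd b c" "b > 0" "c > 0" "b + c = g * 2 ^ k"
    and mn: "3 * (2 * m + n) = g * (2 ^ k - 1) + a"
  shows "\<exists>f. perfect_coloring (doob_vertices m n) (doob_adj m n) f (quotient_matrix b c a)"
proof -
  have "3 * (2 * length ts + length ls) = 3 * (2 * m + n)"
    using arg_cong[OF total, of size] mn by (simp add: size_total_mset size_cover_mset)
  then have lengths: "2 * length ts + length ls = 2 * m + n" by simp
  \<comment> \<open>At most one single line is present, so \<open>2 * m\<close> is at most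
    \<open>2 * length ts + 1\<close>, and parity gives the bound.\<close>
  then have m: "m \<le> length ts" using assms(2) by linarith
  then obtain ts' ls' where "length ts' = m" "length ls' = 2 * (length ts - m) + length ls"
      "total_mset ts' ls' = cover_mset (bits_below k) g a"
    using split_crosses[of m ts ls] total by auto
  moreover from this have "length ls' = n" using lengths m by linarith
  ultimately show ?thesis
    using perfect_coloring_of_cover[of "bits_below k" ts' ls' b c a] bc
    by (simp add: add_bits_below card_bits_below)
qed

theorem theorem6:
  fixes b c g l :: nat
  assumes "b > 0" and "c > 0"
    and "g = gcd b c" and "g > 2"
    and "l \<ge> 2"
    and "b + c = g * 2 ^ (2 * l - 1)"
  shows
    "(even g \<longrightarrow>
       (let t = g div 2; a = (if t mod 3 = 0 then 0 else if t mod 3 = 2 then 2 else 4)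
        in \<forall>m n. 3 * (2 * m + n) = g * (2 ^ (2 * l - 1) - 1) + a \<longrightarrow>
             (\<exists>f. perfect_coloring (doob_vertices m n) (doob_adj m n) f (quotient_matrix b c a)))) \<and>
     (odd g \<longrightarrow>
       (let t = (g - 3) div 2; a = (if t mod 3 = 0 then 0 else if t mod 3 = 2 then 2 else 4)
        in \<forall>m n. 3 * (2 * m + n) = g * (2 ^ (2 * l - 1) - 1) + a \<and> (l \<noteq> 3 \<longrightarrow> m = 0) \<longrightarrow>
             (\<exists>f. perfect_coloring (doob_vertices m n) (doob_adj m n) f (quotient_matrix b c a)))) \<and>
     (odd g \<longrightarrow>
       (let t = (g - 3) div 2; a = (if t mod 3 = 0 then 3 else if t mod 3 = 2 then 5 else 7)
        in \<forall>m. 3 * (2 * m) = g * (2 ^ (2 * l - 1) - 1) + a \<longrightarrow>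
             (\<exists>f. perfect_coloring (doob_vertices m 0) (doob_adj m 0) f (quotient_matrix b c a)))) \<and>
     (odd g \<and> l = 3 \<longrightarrow>
       (let t = (g - 3) div 2; a = (if t mod 3 = 0 then 3 else if t mod 3 = 2 then 5 else 7)
        in \<forall>m n. 3 * (2 * m + n) = g * (2 ^ (2 * l - 1) - 1) + a \<longrightarrow>
             (\<exists>f. perfect_coloring (doob_vertices m n) (doob_adj m n) f (quotient_matrix b c a))))"
proof -
  define K where "K = 2 * l - 1"
  have K: "odd K" "K \<ge> 3" using \<open>l \<ge> 2\<close> by (auto simp: K_def)
  let ?a = "\<lambda>t. if t mod 3 = 0 then 0 else if t mod 3 = 2 then 2 else (4::nat)"
  let ?a' = "\<lambda>t. if t mod 3 = 0 then 3 else if t mod 3 = 2 then 5 else (7::nat)"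
  let ?colored = "\<lambda>m n a. \<exists>f. perfect_coloring (doob_vertices m n) (doob_adj m n) f (quotient_matrix b c a)"
  note coloring = perfect_coloring_of_bits_cover[OF _ _ assms(3,1,2) assms(6)[folded K_def]]
  have odd_g: "3 + 2 * ((g - 3) div 2) = g" if "odd g"
    using that \<open>g > 2\<close> by (auto elim!: oddE)
  have even_case: "?colored m n (?a (g div 2))"
    if g: "even g" and mn: "3 * (2 * m + n) = g * (2 ^ K - 1) + ?a (g div 2)" for m n
  proof -
    have "2 * (g div 2) = g" using g by simp
    then obtain ts where "total_mset ts [] = cover_mset (bits_below K) g (?a (g div 2))"
      using even_cover[OF K, of "g div 2"] by auto
    from coloring[OF this _ mn] show ?thesis by simp
  qed
  have odd_case: "?colored m n (?a ((g - 3) div 2))"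
    if g: "odd g" and mn: "3 * (2 * m + n) = g * (2 ^ K - 1) + ?a ((g - 3) div 2)" for m n
  proof -
    \<comment> \<open>This base cover has no zeros, so \<open>a\<close> comes from the even part
      alone, at the price of one single line \<open>q\<close>.\<close>
    obtain us q where "total_mset us [q] = cover_mset (bits_below 3) 3 0"
      using threefold_cover_bits_below_3(1) by blast
    from extend_threefold_cover[OF K this, of "(g - 3) div 2", unfolded odd_g[OF g] add_0_right]
    obtain ts where "total_mset ts [q] = cover_mset (bits_below K) g (?a ((g - 3) div 2))"
      by blast
    from coloring[OF this _ mn] show ?thesis by simp
  qed
  have odd_case': "?colored m n (?a' ((g - 3) div 2))"
    if g: "odd g" and mn: "3 * (2 * m + n) = g * (2 ^ K - 1) + ?a' ((g - 3) div 2)" for m n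
  proof -
    obtain us :: "(bitvec \<times> bitvec \<times> bitvec) list"
      where "total_mset us [] = cover_mset (bits_below 3) 3 3"
      using threefold_cover_bits_below_3(2) by blast
    note cover = extend_threefold_cover[OF K this, of "(g - 3) div 2", unfolded odd_g[OF g]]
    \<comment> \<open>The three zeros of the base cover without single lines turn 0, 2, 4 into 3, 5,
      7.\<close>
    have "?a ((g - 3) div 2) + 3 = ?a' ((g - 3) div 2)" by simp
    from cover[unfolded this] obtain ts
      where "total_mset ts [] = cover_mset (bits_below K) g (?a' ((g - 3) div 2))"
      by blast
    from coloring[OF this _ mn] show ?thesis by simp
  qed
  show ?thesis
    unfolding Let_def K_def[symmetric]
  proof (intro conjI impI allI)
    fix m n
    show "?colored m n (?a (g div 2))"
      if "even g" "3 * (2 * m + n) = g * (2 ^ K - 1) + ?a (g div 2)"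
      using that by (rule even_case)
    show "?colored m n (?a ((g - 3) div 2))"
      if "odd g" "3 * (2 * m + n) = g * (2 ^ K - 1) + ?a ((g - 3) div 2) \<and> (l \<noteq> 3 \<longrightarrow> m = 0)"
      using that(1) conjunct1[OF that(2)] by (rule odd_case)
    show "?colored m 0 (?a' ((g - 3) div 2))"
      if "odd g" "3 * (2 * m) = g * (2 ^ K - 1) + ?a' ((g - 3) div 2)"
      by (rule odd_case'[OF that(1)]) (simp only: that(2) add_0_right)
    show "?colored m n (?a' ((g - 3) div 2))"
      if "odd g \<and> l = 3" "3 * (2 * m + n) = g * (2 ^ K - 1) + ?a' ((g - 3) div 2)"
      using conjunct1[OF that(1)] that(2) by (rule odd_case')
  qed
qed

end
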